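(* Let $E$ be a finite set of items with random realization $\Phi\sim p$, let $M\subseteq G$ be a set of $m$ training tasks, let $0<l<k$ be integers, and suppose that the utility function $f^i$ is adaptive submodular and adaptive monotone for every task $i\in G$. Let $\pi^{g}$ be the two-phase greedy policy with parameters $l,k$, and let $\pi^{o}$ be an optimal policy for the adaptive submodular meta-learning problem $\max_{S\subseteq E,\,|S|=l}\ \max_{\pi\in\Omega(S,k)} f_{avg}(\pi)$. Then $\pi^g$ achieves a $1/2$ approximation ratio, i.e. $$f_{avg}(\pi^{g})\ \ge\ \tfrac12\, f_{avg}(\pi^{o}).$$
   Context: Items and states. $E$ is a finite set of $n$ items and $O$ a set of states. A realization is a function $\phi:E\to O$; $\Phi$ denotes the random realization, distributed according to a known (discrete) prior $p$. A partial realization $\psi$ is a function from a subset $\mathrm{dom}(\psi)\subseteq E$ to $O$; $\Phi\sim\psi$ means that $\Phi$ agrees with $\psi$ on $\mathrm{dom}(\psi)$; $\psi\subseteq\psi'$ means $\mathrm{dom}(\psi)\subseteq\mathrm{dom}(\psi')$ and the two agree on $\mathrm{dom}(\psi)$. Only partial realizations with $\Pr[\Phi\sim\psi]>0$ are considered. An item's state is observed only upon selecting it. Tasks. $G$ is a family of tasks; each $i\in G$ has a utility function $f^i:2^E\times O^E\to\mathbb{R}_{\ge 0}$. $M\subseteq G$ is a set of $m$ training tasks. All expectations appearing are assumed finite. For $Y\subseteq E$, $f^i(Y)=\mathbb{E}_{\Phi\sim p}[f^i(Y,\Phi)]$. The conditional expected marginal utility is $\Delta_i(e\mid\psi)=\mathbb{E}[f^i(\mathrm{dom}(\psi)\cup\{e\},\Phi)-f^i(\mathrm{dom}(\psi),\Phi)\mid\Phi\sim\psi]$.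 $f^i$ is adaptive submodular if $\Delta_i(e\mid\psi)\ge\Delta_i(e\mid\psi')$ for all $\psi\subseteq\psi'$ and $e\in E\setminus\mathrm{dom}(\psi')$; it is adaptive monotone if $\Delta_i(e\mid\psi)\ge0$ for all $\psi$ and $e\in E\setminus\mathrm{dom}(\psi)$. Policies. A (possibly randomized) adaptive policy $\pi$ chooses the next item to select (or stops) based on the current task and the partial realization observed so far. $E(\pi,\phi,i)$ is the (random) set of items it selects under realization $\phi$ for task $i$. $f^i_{avg}(\pi)=\mathbb{E}[f^i(E(\pi,\Phi,i),\Phi)]$, the expectation being over $\Phi\sim p$ and the internal randomness of $\pi$ (independent of $\Phi$), and $f_{avg}(\pi)=\frac1m\sum_{i\in M}f^i_{avg}(\pi)$. $\Omega(S,k)$ is the set of policies that, for every task, first select all items of $S$ (the same $S$ for all tasks), then may adaptively select further items depending on the task and observed states, with $|E(\pi,\phi,i)|\le k$ for all $\phi$ with $p(\phi)>0$. Two-phase greedy policy $\pi^g$. Initialization: start with $S^g=\emptyset$; $l$ times, add to $S^g$ an item $e\in E$ maximizing $\frac1m\sum_{i\in M}(f^i(S^g\cup\{e\})-f^i(S^g))$. Execution for an incoming task $i$: select all of $S^g$ and observe their states, giving the partial realization $\psi^{g_l}$; then for rounds $t=l+1,\dots,k$ select $e_t\in\arg\max_{e\in E}\Delta_i(e\mid\psi^{g_{t-1}})$, observe its state, and set $\psi^{g_t}=\psi^{g_{t-1}}\cup\{\phi(e_t)\}$. Ties are broken arbitrarily. *)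

theory Defs
  imports "HOL-Probability.Probability"
begin

text \<open>The finite item set is the type \<open>'e\<close>, the states are the elements of the type \<open>'o\<close>, a
  realization is a function \<open>'e \<Rightarrow> 'o\<close>, and a partial realization is a map \<open>'e \<rightharpoonup> 'o\<close>.\<close>

definition agrees :: "('e \<Rightarrow> 'o) \<Rightarrow> ('e \<rightharpoonup> 'o) \<Rightarrow> bool" where
  "agrees \<phi> \<psi> \<longleftrightarrow> (\<forall>e\<in>dom \<psi>. \<psi> e = Some (\<phi> e))"

definition possible :: "('e \<Rightarrow> 'o) pmf \<Rightarrow> ('e \<rightharpoonup> 'o) \<Rightarrow> bool" where
  "possible p \<psi> \<longleftrightarrow> measure_pmf.prob p {\<phi>. agrees \<phi> \<psi>} > 0"

definition possible_states :: "('e \<Rightarrow> 'o) pmf \<Rightarrow> ('e \<rightharpoonup> 'o) \<Rightarrow> 'e \<Rightarrow> 'o set" where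
  "possible_states p \<psi> e = {\<phi> e | \<phi>. \<phi> \<in> set_pmf p \<and> agrees \<phi> \<psi>}"

type_synonym ('e, 'o) utility = "'e set \<Rightarrow> ('e \<Rightarrow> 'o) \<Rightarrow> real"

definition expected_utility :: "('e \<Rightarrow> 'o) pmf \<Rightarrow> ('e, 'o) utility \<Rightarrow> 'e set \<Rightarrow> real" where
  "expected_utility p u Y = measure_pmf.expectation p (\<lambda>\<phi>. u Y \<phi>)"

text \<open>Meaningful only for \<open>possible p \<psi>\<close>, since \<^const>\<open>cond_pmf\<close> is unspecified on null events.\<close>

definition marginal :: "('e \<Rightarrow> 'o) pmf \<Rightarrow> ('e, 'o) utility \<Rightarrow> 'e \<Rightarrow> ('e \<rightharpoonup> 'o) \<Rightarrow> real" where
  "marginal p u e \<psi> = measure_pmf.expectation (cond_pmf p {\<phi>. agrees \<phi> \<psi>})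
     (\<lambda>\<phi>. u (dom \<psi> \<union> {e}) \<phi> - u (dom \<psi>) \<phi>)"

definition adaptive_submodular :: "('e \<Rightarrow> 'o) pmf \<Rightarrow> ('e, 'o) utility \<Rightarrow> bool" where
  "adaptive_submodular p u \<longleftrightarrow>
     (\<forall>\<psi> \<psi>' e. possible p \<psi> \<longrightarrow> possible p \<psi>' \<longrightarrow> \<psi> \<subseteq>\<^sub>m \<psi>' \<longrightarrow> e \<notin> dom \<psi>' \<longrightarrow>
        marginal p u e \<psi> \<ge> marginal p u e \<psi>')"

definition adaptive_monotone :: "('e \<Rightarrow> 'o) pmf \<Rightarrow> ('e, 'o) utility \<Rightarrow> bool" where
  "adaptive_monotone p u \<longleftrightarrow>
     (\<forall>\<psi> e. possible p \<psi> \<longrightarrow> e \<notin> dom \<psi> \<longrightarrow> marginal p u e \<psi> \<ge> 0)"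

text \<open>What an adaptive policy does on one task is a decision tree in which every branch is finite:
  it stops, or selects an item and continues depending on the observed state, or tosses a coin
  of its own. A node of the tree stands for the sequence of selections and observations so far.
  Selecting an item again is allowed and has no effect on the set of selected items.\<close>

datatype ('e, 'o) plan =
    Stop
  | Select 'e "'o \<Rightarrow> ('e, 'o) plan"
  | Randomize "('e, 'o) plan pmf"

type_synonym ('g, 'e, 'o) policy = "'g \<Rightarrow> ('e, 'o) plan"

primrec plan_items :: "('e, 'o) plan \<Rightarrow> ('e \<Rightarrow> 'o) \<Rightarrow> 'e set pmf" where
  "plan_items Stop = (\<lambda>\<phi>. return_pmf {})"
| "plan_items (Select e c) = (\<lambda>\<phi>. map_pmf (insert e) (plan_items (c (\<phi> e)) \<phi>))"
| "plan_items (Randomize D) = (\<lambda>\<phi>. join_pmf (map_pmf (\<lambda>g. g \<phi>) (map_pmf plan_items D)))"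

definition selected_items :: "('g, 'e, 'o) policy \<Rightarrow> ('e \<Rightarrow> 'o) \<Rightarrow> 'g \<Rightarrow> 'e set pmf" where
  "selected_items \<pi> \<phi> i = plan_items (\<pi> i) \<phi>"

definition task_value ::
    "('e \<Rightarrow> 'o) pmf \<Rightarrow> ('g \<Rightarrow> ('e, 'o) utility) \<Rightarrow> ('g, 'e, 'o) policy \<Rightarrow> 'g \<Rightarrow> real" where
  "task_value p f \<pi> i = measure_pmf.expectation
     (bind_pmf p (\<lambda>\<phi>. map_pmf (\<lambda>Y. (Y, \<phi>)) (selected_items \<pi> \<phi> i))) (\<lambda>(Y, \<phi>). f i Y \<phi>)"

definition average_value ::
    "('e \<Rightarrow> 'o) pmf \<Rightarrow> ('g \<Rightarrow> ('e, 'o) utility) \<Rightarrow> 'g set \<Rightarrow> ('g, 'e, 'o) policy \<Rightarrow> real" where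
  "average_value p f M \<pi> = 1 / real (card M) * (\<Sum>i\<in>M. task_value p f \<pi> i)"

text \<open>\<open>first_then p Q S \<psi> t\<close>: having observed \<open>\<psi>\<close>, the plan \<open>t\<close> first selects all items of \<open>S\<close>, in any
  order, and then follows a plan that satisfies \<open>Q\<close> with the partial realization observed by then.
  Nothing is required of continuations for states that cannot be observed.\<close>

inductive first_then ::
    "('e \<Rightarrow> 'o) pmf \<Rightarrow> (('e \<rightharpoonup> 'o) \<Rightarrow> ('e, 'o) plan \<Rightarrow> bool) \<Rightarrow>
     'e set \<Rightarrow> ('e \<rightharpoonup> 'o) \<Rightarrow> ('e, 'o) plan \<Rightarrow> bool"
  for p Q where
  finished: "Q \<psi> t \<Longrightarrow> first_then p Q {} \<psi> t"
| select: "e \<in> S \<Longrightarrow>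
    (\<And>s. s \<in> possible_states p \<psi> e \<Longrightarrow> first_then p Q (S - {e}) (\<psi>(e \<mapsto> s)) (c s)) \<Longrightarrow>
    first_then p Q S \<psi> (Select e c)"
| randomize: "(\<And>t. t \<in> set_pmf D \<Longrightarrow> first_then p Q S \<psi> t) \<Longrightarrow>
    first_then p Q S \<psi> (Randomize D)"

definition meta_policies ::
    "('e \<Rightarrow> 'o) pmf \<Rightarrow> 'g set \<Rightarrow> 'e set \<Rightarrow> nat \<Rightarrow> ('g, 'e, 'o) policy set" where
  "meta_policies p G S k = {\<pi>. \<forall>i\<in>G.
     first_then p (\<lambda>_ _. True) S Map.empty (\<pi> i) \<and>
     (\<forall>\<phi>\<in>set_pmf p. \<forall>Y\<in>set_pmf (selected_items \<pi> \<phi> i). card Y \<le> k)}"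

definition optimal_meta_policy ::
    "('e \<Rightarrow> 'o) pmf \<Rightarrow> ('g \<Rightarrow> ('e, 'o) utility) \<Rightarrow> 'g set \<Rightarrow> 'g set \<Rightarrow> nat \<Rightarrow> nat \<Rightarrow>
     ('g, 'e, 'o) policy \<Rightarrow> bool" where
  "optimal_meta_policy p f G M l k \<pi> \<longleftrightarrow>
     (\<exists>S. card S = l \<and> \<pi> \<in> meta_policies p G S k) \<and>
     (\<forall>S' \<pi>'. card S' = l \<longrightarrow> \<pi>' \<in> meta_policies p G S' k \<longrightarrow>
        average_value p f M \<pi>' \<le> average_value p f M \<pi>)"

text \<open>Both greedy phases maximize over all items, so a tie may be resolved in favour of an item that
  has been selected before; the round then adds nothing.\<close>

inductive greedy_initial_set ::
    "('e \<Rightarrow> 'o) pmf \<Rightarrow> ('g \<Rightarrow> ('e, 'o) utility) \<Rightarrow> 'g set \<Rightarrow> nat \<Rightarrow> 'e set \<Rightarrow> bool"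
  for p f M where
  "greedy_initial_set p f M 0 {}"
| "greedy_initial_set p f M j S \<Longrightarrow>
   is_arg_max (\<lambda>e. 1 / real (card M) *
       (\<Sum>i\<in>M. expected_utility p (f i) (S \<union> {e}) - expected_utility p (f i) S))
     (\<lambda>e. e \<in> UNIV) e \<Longrightarrow>
   greedy_initial_set p f M (Suc j) (S \<union> {e})"

inductive greedy_rounds ::
    "('e \<Rightarrow> 'o) pmf \<Rightarrow> ('e, 'o) utility \<Rightarrow> nat \<Rightarrow> ('e \<rightharpoonup> 'o) \<Rightarrow> ('e, 'o) plan \<Rightarrow> bool"
  for p u where
  stop: "greedy_rounds p u 0 \<psi> Stop"
| select: "is_arg_max (\<lambda>e. marginal p u e \<psi>) (\<lambda>e. e \<in> UNIV) e \<Longrightarrow>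
    (\<And>s. s \<in> possible_states p \<psi> e \<Longrightarrow> greedy_rounds p u r (\<psi>(e \<mapsto> s)) (c s)) \<Longrightarrow>
    greedy_rounds p u (Suc r) \<psi> (Select e c)"
| randomize: "(\<And>t. t \<in> set_pmf D \<Longrightarrow> greedy_rounds p u r \<psi> t) \<Longrightarrow>
    greedy_rounds p u r \<psi> (Randomize D)"

text \<open>The policies that the two-phase greedy algorithm can produce, one for each way to break ties.\<close>

definition two_phase_greedy ::
    "('e \<Rightarrow> 'o) pmf \<Rightarrow> ('g \<Rightarrow> ('e, 'o) utility) \<Rightarrow> 'g set \<Rightarrow> 'g set \<Rightarrow> nat \<Rightarrow> nat \<Rightarrow>
     ('g, 'e, 'o) policy \<Rightarrow> bool" where
  "two_phase_greedy p f G M l k \<pi> \<longleftrightarrow>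
     (\<exists>S. greedy_initial_set p f M l S \<and>
        (\<forall>i\<in>G. first_then p (greedy_rounds p (f i) (k - l)) S Map.empty (\<pi> i)))"

end

(* Let S be the greedily chosen initial set and T the initial set of the optimal policy, and run the
   optimal policy after the greedy one. By adaptive monotonicity the combination is worth at least as
   much as the optimal policy. What it adds to the greedy policy is at most the sum of the gains, after
   the whole greedy run, of the l items of T and of at most k - l further items. By adaptive
   submodularity the former, averaged over the tasks, are dominated by the l greedy steps that build S,
   and the latter by the k - l adaptive greedy rounds; so in total the combination adds at most the value
   of the greedy policy itself.

   The tree recursion is done for a fixed realization phi: the probability visit t A phi B e depends on
   phi only through its restriction to B, so a change of utility from B to B plus e, weighted with
   it, can be replaced in expectation by the conditional expected marginal utility given phi on B. *)

theory Submission
  imports Defs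
begin

section \<open>Iterated expectations over discrete distributions\<close>

text \<open>Tonelli: a finite total makes the inner integrals finite almost everywhere, which for a
  pmf means on the whole support.\<close>

lemma integral_bind_pmf_nonneg:
  fixes F :: "'b \<Rightarrow> real"
  assumes int: "integrable (measure_pmf (bind_pmf p q)) F" and nn: "\<And>y. 0 \<le> F y"
  shows "\<And>x. x \<in> set_pmf p \<Longrightarrow> integrable (measure_pmf (q x)) F"
    and "integrable (measure_pmf p) (\<lambda>x. measure_pmf.expectation (q x) F)"
    and "measure_pmf.expectation (bind_pmf p q) F =
      measure_pmf.expectation p (\<lambda>x. measure_pmf.expectation (q x) F)"
proof -
  have fin: "(\<integral>\<^sup>+x. \<integral>\<^sup>+y. ennreal (F y) \<partial>q x \<partial>p) < \<infinity>"
    using int nn by (simp add: integrable_iff_bounded)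
  then have "AE x in p. (\<integral>\<^sup>+y. ennreal (F y) \<partial>q x) \<noteq> \<infinity>"
    by (intro nn_integral_PInf_AE) auto
  then show inner: "integrable (measure_pmf (q x)) F" if "x \<in> set_pmf p" for x
    using that nn by (simp add: AE_measure_pmf_iff integrable_iff_bounded top.not_eq_extremum)
  have eq: "(\<integral>\<^sup>+x. \<integral>\<^sup>+y. ennreal (F y) \<partial>q x \<partial>p) =
      (\<integral>\<^sup>+x. ennreal (measure_pmf.expectation (q x) F) \<partial>p)"
    using inner nn
    by (intro nn_integral_cong_AE) (simp add: AE_measure_pmf_iff nn_integral_eq_integral)
  have pos: "0 \<le> measure_pmf.expectation (q x) F" for x
    using nn by (simp add: integral_nonneg_AE)
  show "integrable (measure_pmf p) (\<lambda>x. measure_pmf.expectation (q x) F)"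
    using fin eq pos by (simp add: integrable_iff_bounded)
  show "measure_pmf.expectation (bind_pmf p q) F =
      measure_pmf.expectation p (\<lambda>x. measure_pmf.expectation (q x) F)"
    using nn pos eq by (simp add: integral_eq_nn_integral)
qed

text \<open>Splitting into positive and negative parts. Signs matter because monotonicity holds only
  in conditional expectation: a single realization may lose utility.\<close>

lemma integral_bind_pmf_integrable:
  fixes F :: "'b \<Rightarrow> real"
  assumes int: "integrable (measure_pmf (bind_pmf p q)) F"
  shows "integrable (measure_pmf p) (\<lambda>x. measure_pmf.expectation (q x) F)"
    and "measure_pmf.expectation (bind_pmf p q) F =
      measure_pmf.expectation p (\<lambda>x. measure_pmf.expectation (q x) F)"
proof -
  let ?P = "\<lambda>y. max 0 (F y)" and ?N = "\<lambda>y. max 0 (- F y)"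
  have F: "F = (\<lambda>y. ?P y - ?N y)"
    by auto
  have P: "integrable (measure_pmf (bind_pmf p q)) ?P"
    and N: "integrable (measure_pmf (bind_pmf p q)) ?N"
    using int by auto
  note P' = integral_bind_pmf_nonneg[OF P] and N' = integral_bind_pmf_nonneg[OF N]
  have eq: "measure_pmf.expectation (q x) F =
      measure_pmf.expectation (q x) ?P - measure_pmf.expectation (q x) ?N" if "x \<in> set_pmf p" for x
    using P'(1)[OF _ that] N'(1)[OF _ that]
    by (subst F) (auto intro!: Bochner_Integration.integral_diff)
  have "integrable (measure_pmf p)
      (\<lambda>x. measure_pmf.expectation (q x) ?P - measure_pmf.expectation (q x) ?N)"
    using P'(2) N'(2) by auto
  then show "integrable (measure_pmf p) (\<lambda>x. measure_pmf.expectation (q x) F)"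
    by (subst integrable_cong_AE[where g = "\<lambda>x. measure_pmf.expectation (q x) ?P -
        measure_pmf.expectation (q x) ?N"]) (auto simp: AE_measure_pmf_iff eq)
  have "measure_pmf.expectation (bind_pmf p q) F =
      measure_pmf.expectation (bind_pmf p q) ?P - measure_pmf.expectation (bind_pmf p q) ?N"
    by (subst F) (rule Bochner_Integration.integral_diff[OF P N])
  also have "\<dots> = measure_pmf.expectation p
      (\<lambda>x. measure_pmf.expectation (q x) ?P - measure_pmf.expectation (q x) ?N)"
    using P'(2,3) N'(2,3) by (simp add: Bochner_Integration.integral_diff)
  also have "\<dots> = measure_pmf.expectation p (\<lambda>x. measure_pmf.expectation (q x) F)"
    by (intro integral_cong_AE) (auto simp: AE_measure_pmf_iff eq)
  finally show "measure_pmf.expectation (bind_pmf p q) F =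
      measure_pmf.expectation p (\<lambda>x. measure_pmf.expectation (q x) F)" .
qed

lemma integrable_mult_bounded:
  fixes w h :: "'a \<Rightarrow> real"
  assumes "integrable (measure_pmf p) h" and "\<And>x. \<bar>w x\<bar> \<le> 1"
  shows "integrable (measure_pmf p) (\<lambda>x. w x * h x)"
  using assms by (intro Bochner_Integration.integrable_bound[OF assms(1)])
    (auto simp: abs_mult intro!: AE_I2 mult_left_le_one_le)

subsection \<open>Conditional expected marginal utilities\<close>

text \<open>Every possible partial realization has this form; the encoding lets arguments fix
  \<open>\<phi>\<close> and vary only the item set.\<close>

definition observe :: "('e \<Rightarrow> 'o) \<Rightarrow> 'e set \<Rightarrow> ('e \<rightharpoonup> 'o)" where
  "observe \<phi> A = (\<lambda>e. if e \<in> A then Some (\<phi> e) else None)"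

definition depends_on :: "'e set \<Rightarrow> (('e \<Rightarrow> 'o) \<Rightarrow> 'a) \<Rightarrow> bool" where
  "depends_on A w \<longleftrightarrow> (\<forall>\<phi> \<phi>'. (\<forall>e\<in>A. \<phi> e = \<phi>' e) \<longrightarrow> w \<phi> = w \<phi>')"

definition gain :: "('e \<Rightarrow> 'o) pmf \<Rightarrow> ('e, 'o) utility \<Rightarrow> 'e set \<Rightarrow> ('e \<Rightarrow> 'o) \<Rightarrow> 'e \<Rightarrow> real" where
  "gain p u A \<phi> e = marginal p u e (observe \<phi> A)"

lemma dom_observe [simp]: "dom (observe \<phi> A) = A"
  by (auto simp: observe_def split: if_splits)

lemma observe_empty [simp]: "observe \<phi> {} = Map.empty"
  by (auto simp: observe_def)

lemma observe_insert [simp]: "observe \<phi> (insert e A) = (observe \<phi> A)(e \<mapsto> \<phi> e)"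
  by (auto simp: observe_def)

lemma observe_mono: "A \<subseteq> B \<Longrightarrow> observe \<phi> A \<subseteq>\<^sub>m observe \<phi> B"
  by (auto simp: observe_def map_le_def)

lemma agrees_observe: "agrees \<phi>' (observe \<phi> A) \<longleftrightarrow> (\<forall>e\<in>A. \<phi>' e = \<phi> e)"
  unfolding agrees_def dom_observe by (auto simp: observe_def)

lemma possible_observe: "\<phi> \<in> set_pmf p \<Longrightarrow> possible p (observe \<phi> A)"
  unfolding possible_def by (rule measure_pmf_posI) (auto simp: agrees_observe)

lemma possible_states_observe:
  "\<phi> \<in> set_pmf p \<Longrightarrow> \<phi> e \<in> possible_states p (observe \<phi> A) e"
  by (auto simp: possible_states_def agrees_observe)

lemma depends_on_mono: "depends_on A w \<Longrightarrow> A \<subseteq> B \<Longrightarrow> depends_on B w"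
  unfolding depends_on_def by (meson subsetD)

lemma depends_on_mult:
  "depends_on A v \<Longrightarrow> depends_on A w \<Longrightarrow> depends_on A (\<lambda>\<phi>. v \<phi> * w \<phi> :: real)"
  unfolding depends_on_def by metis

text \<open>Law of total probability: agreement on \<open>A\<close> is an equivalence relation, and
  resampling within the class of \<open>\<phi>\<close> leaves \<open>p\<close> unchanged.\<close>

lemma bind_observe_cond_pmf: "bind_pmf p (\<lambda>\<phi>. cond_pmf p {\<phi>'. agrees \<phi>' (observe \<phi> A)}) = p"
proof -
  have eq: "agrees \<phi>' (observe \<phi> A) \<longleftrightarrow> (\<forall>e\<in>A. \<phi> e = \<phi>' e)" for \<phi> \<phi>' :: "'a \<Rightarrow> 'b"
    by (auto simp: agrees_observe)
  have "measure_pmf.prob p {\<phi>'. \<forall>e\<in>A. \<phi> e = \<phi>' e} = measure_pmf.prob p {\<phi>. \<forall>e\<in>A. \<phi> e = \<phi>'' e}"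
    if "\<forall>e\<in>A. \<phi> e = \<phi>'' e" for \<phi> \<phi>''
    using that by (intro arg_cong[where f = "measure_pmf.prob p"]) auto
  then show ?thesis
    unfolding eq by (intro bind_cond_pmf_cancel[of p p]) auto
qed

text \<open>Taking out what is known: \<open>w\<close> is constant on each event of agreement on
  \<open>A\<close>, so it passes through the conditional expectation. Its bound secures
  integrability.\<close>

lemma expectation_gain:
  assumes int: "\<And>Y. integrable (measure_pmf p) (u Y)"
    and w: "depends_on A w" "\<And>\<phi>. \<bar>w \<phi>\<bar> \<le> (1::real)"
  shows "integrable (measure_pmf p) (\<lambda>\<phi>. w \<phi> * gain p u A \<phi> e)"
    and "measure_pmf.expectation p (\<lambda>\<phi>. w \<phi> * gain p u A \<phi> e) =
      measure_pmf.expectation p (\<lambda>\<phi>. w \<phi> * (u (insert e A) \<phi> - u A \<phi>))"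
proof -
  let ?q = "\<lambda>\<phi>. cond_pmf p {\<phi>'. agrees \<phi>' (observe \<phi> A)}"
  let ?h = "\<lambda>\<phi>. w \<phi> * (u (insert e A) \<phi> - u A \<phi>)"
  have "integrable (measure_pmf p) ?h"
    using int w by (intro integrable_mult_bounded) auto
  then have h: "integrable (measure_pmf (bind_pmf p ?q)) ?h"
    by (simp add: bind_observe_cond_pmf)
  have eq: "measure_pmf.expectation (?q \<phi>) ?h = w \<phi> * gain p u A \<phi> e" if "\<phi> \<in> set_pmf p" for \<phi>
  proof -
    have ne: "set_pmf p \<inter> {\<phi>'. agrees \<phi>' (observe \<phi> A)} \<noteq> {}"
      using that by (auto simp: agrees_observe)
    have "measure_pmf.expectation (?q \<phi>) ?h =
        measure_pmf.expectation (?q \<phi>) (\<lambda>\<phi>'. w \<phi> * (u (insert e A) \<phi>' - u A \<phi>'))"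
    proof (intro integral_cong_AE)
      have "w \<phi>' = w \<phi>" if "agrees \<phi>' (observe \<phi> A)" for \<phi>'
        using w(1) that by (auto simp: depends_on_def agrees_observe)
      then show "AE x in ?q \<phi>. ?h x = w \<phi> * (u (insert e A) x - u A x)"
        by (auto simp: AE_measure_pmf_iff set_cond_pmf[OF ne])
    qed auto
    then show ?thesis
      by (simp add: gain_def marginal_def)
  qed
  show "integrable (measure_pmf p) (\<lambda>\<phi>. w \<phi> * gain p u A \<phi> e)"
    using integral_bind_pmf_integrable(1)[OF h]
    by (subst integrable_cong_AE[where g = "\<lambda>\<phi>. measure_pmf.expectation (?q \<phi>) ?h"])
       (auto simp: AE_measure_pmf_iff eq)
  have "measure_pmf.expectation p (\<lambda>\<phi>. w \<phi> * gain p u A \<phi> e) =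
      measure_pmf.expectation p (\<lambda>\<phi>. measure_pmf.expectation (?q \<phi>) ?h)"
    by (intro integral_cong_AE) (auto simp: AE_measure_pmf_iff eq)
  also have "\<dots> = measure_pmf.expectation p ?h"
    using integral_bind_pmf_integrable(2)[OF h] by (simp add: bind_observe_cond_pmf)
  finally show "measure_pmf.expectation p (\<lambda>\<phi>. w \<phi> * gain p u A \<phi> e) =
      measure_pmf.expectation p ?h" .
qed

subsection \<open>Decision trees for a fixed realization\<close>

lemma plan_items_Randomize [simp]:
  "plan_items (Randomize D) \<phi> = bind_pmf D (\<lambda>t. plan_items t \<phi>)"
  by (simp add: join_eq_bind_pmf bind_map_pmf)

declare plan_items.simps(3) [simp del]

text \<open>A plan that ends with \<open>Y\<close> has observed only states of items in
  \<open>Y\<close>. This makes the probability an admissible weight in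
  \<open>expectation_path_sum\<close>.\<close>

lemma depends_on_plan_items: "depends_on Y (\<lambda>\<phi>. pmf (plan_items t \<phi>) Y)"
  for t :: "('e::finite, 'o) plan"
proof (induction t arbitrary: Y)
  case Stop
  then show ?case
    by (simp add: depends_on_def)
next
  case (Select x c)
  \<comment> \<open>If \<open>x \<in> Y\<close>, both \<open>Y\<close> and \<open>Y - {x}\<close>
    qualify as \<open>Z\<close>, since \<open>x\<close> may be selected again; otherwise no
    \<open>Z\<close> does.\<close>
  have eq: "pmf (plan_items (Select x c) \<phi>) Y =
      (\<Sum>Z | insert x Z = Y. pmf (plan_items (c (\<phi> x)) \<phi>) Z)" for \<phi>
    by (simp add: pmf_map vimage_def measure_measure_pmf_finite)
  show ?case
    unfolding depends_on_def eq
  proof (intro allI impI sum.cong refl)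
    fix \<phi> \<phi>' :: "'e \<Rightarrow> 'o" and Z
    assume agree: "\<forall>e\<in>Y. \<phi> e = \<phi>' e" and Z: "Z \<in> {Z. insert x Z = Y}"
    then have "\<phi> x = \<phi>' x" "\<forall>e\<in>Z. \<phi> e = \<phi>' e"
      by auto
    then show "pmf (plan_items (c (\<phi> x)) \<phi>) Z = pmf (plan_items (c (\<phi>' x)) \<phi>') Z"
      using Select.IH[of "c (\<phi>' x)" Z] by (simp add: depends_on_def)
  qed
next
  case (Randomize D)
  show ?case
    unfolding depends_on_def plan_items_Randomize pmf_bind
  proof (intro allI impI integral_cong_AE)
    fix \<phi> \<phi>' :: "'e \<Rightarrow> 'o"
    assume "\<forall>e\<in>Y. \<phi> e = \<phi>' e"
    then show "AE t in D. pmf (plan_items t \<phi>) Y = pmf (plan_items t \<phi>') Y"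
      using Randomize.IH by (auto simp: AE_measure_pmf_iff depends_on_def)
  qed auto
qed

text \<open>The probability that the plan, started with the items \<open>A\<close> already selected, selects the new
  item \<open>e\<close> at a moment when the set of selected items is \<open>B\<close>.\<close>

primrec visit :: "('e, 'o) plan \<Rightarrow> 'e set \<Rightarrow> ('e \<Rightarrow> 'o) \<Rightarrow> 'e set \<Rightarrow> 'e \<Rightarrow> real" where
  "visit Stop = (\<lambda>A \<phi> B e. 0)"
| "visit (Select x c) = (\<lambda>A \<phi> B e.
     (if A = B \<and> x = e \<and> e \<notin> B then 1 else 0) + visit (c (\<phi> x)) (insert x A) \<phi> B e)"
| "visit (Randomize D) = (\<lambda>A \<phi> B e.
     measure_pmf.expectation (map_pmf visit D) (\<lambda>v. v A \<phi> B e))"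

lemma visit_outside: "\<not> A \<subseteq> B \<or> e \<in> B \<Longrightarrow> visit t A \<phi> B e = 0"
proof (induction t arbitrary: A)
  case (Randomize D)
  then have "(\<integral>t. visit t A \<phi> B e \<partial>D) = (\<integral>t. 0 \<partial>D)"
    by (intro integral_cong_AE) (auto simp: AE_measure_pmf_iff)
  then show ?case
    by simp
qed auto

lemma visit_bounds: "0 \<le> visit t A \<phi> B e \<and> visit t A \<phi> B e \<le> 1"
proof (induction t arbitrary: A)
  case (Select x c)
  \<comment> \<open>If the indicator is 1, then \<open>insert x A\<close> is no longer inside
    \<open>B\<close>, so the second summand vanishes.\<close>
  show ?case
    using Select.IH[of "c (\<phi> x)" "insert x A"] visit_outside[of "insert x A" B e "c (\<phi> x)" \<phi>] by auto
next
  case (Randomize D)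
  have "AE t in D. \<bar>visit t A \<phi> B e\<bar> \<le> 1"
    using Randomize.IH by (auto simp: AE_measure_pmf_iff)
  then have "integrable (measure_pmf D) (\<lambda>t. visit t A \<phi> B e)"
    by (intro measure_pmf.integrable_const_bound[where B = 1]) auto
  then show ?case
    using Randomize.IH
    by (auto intro!: integral_nonneg_AE measure_pmf.integral_le_const simp: AE_measure_pmf_iff)
qed auto

lemma visit_nonneg [simp]: "0 \<le> visit t A \<phi> B e"
  and visit_le_1 [simp]: "visit t A \<phi> B e \<le> 1"
  using visit_bounds by metis+

lemma integrable_visit [simp]: "integrable (measure_pmf D) (\<lambda>t. visit t A \<phi> B e)"
  by (intro measure_pmf.integrable_const_bound[where B = 1]) auto

text \<open>While the selected set stays inside \<open>B\<close>, only states in \<open>B\<close>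
  are seen. After selecting some \<open>x\<close> outside \<open>B\<close> the plan never returns to
  \<open>B\<close>, so the state of \<open>x\<close> is irrelevant.\<close>

lemma depends_on_visit: "depends_on B (\<lambda>\<phi>. visit t A \<phi> B e)"
proof (induction t arbitrary: A)
  case Stop
  then show ?case
    by (simp add: depends_on_def)
next
  case (Select x c)
  show ?case
  proof (cases "x \<in> B")
    case True
    then show ?thesis
      using Select.IH[of _ "insert x A"] by (fastforce simp: depends_on_def)
  next
    case False
    then show ?thesis
      by (simp add: depends_on_def visit_outside)
  qed
next
  case (Randomize D)
  show ?case
    unfolding depends_on_def visit.simps integral_map_pmf
  proof (intro allI impI integral_cong_AE)
    fix \<phi> \<phi>' :: "'a \<Rightarrow> 'b"
    assume "\<forall>e\<in>B. \<phi> e = \<phi>' e"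
    then show "AE t in D. visit t A \<phi> B e = visit t A \<phi>' B e"
      using Randomize.IH by (auto simp: AE_measure_pmf_iff depends_on_def)
  qed auto
qed

text \<open>Expected sum, over the plan's coin tosses, of \<open>F B e\<close> over its new
  selections under \<open>\<phi>\<close>. A finite sum over all pairs allows expectations over
  \<open>p\<close> to be exchanged term by term.\<close>

definition path_sum ::
    "('e::finite set \<Rightarrow> 'e \<Rightarrow> real) \<Rightarrow> ('e, 'o) plan \<Rightarrow> 'e set \<Rightarrow> ('e \<Rightarrow> 'o) \<Rightarrow> real" where
  "path_sum F t A \<phi> = (\<Sum>B\<in>UNIV. \<Sum>e\<in>UNIV. visit t A \<phi> B e * F B e)"

lemma path_sum_Stop [simp]: "path_sum F Stop A \<phi> = 0"
  by (simp add: path_sum_def)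

lemma path_sum_Select [simp]:
  "path_sum F (Select x c) A \<phi> =
     (if x \<in> A then 0 else F A x) + path_sum F (c (\<phi> x)) (insert x A) \<phi>"
proof -
  have "(\<Sum>e\<in>UNIV. (if A = B \<and> x = e \<and> e \<notin> B then 1 else 0) * F B e) =
      (\<Sum>e\<in>UNIV. if e = x then if A = B \<and> x \<notin> B then F B x else 0 else 0)" for B
    by (intro sum.cong) auto
  then have "(\<Sum>e\<in>UNIV. (if A = B \<and> x = e \<and> e \<notin> B then 1 else 0) * F B e) =
      (if B = A then if x \<in> A then 0 else F A x else 0)" for B
    by auto
  then show ?thesis
    by (simp add: path_sum_def distrib_right sum.distrib)
qed

lemma path_sum_Randomize [simp]:
  "path_sum F (Randomize D) A \<phi> = measure_pmf.expectation D (\<lambda>t. path_sum F t A \<phi>)"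
  by (simp add: path_sum_def)

lemma integrable_path_sum [simp]: "integrable (measure_pmf D) (\<lambda>t. path_sum F t A \<phi>)"
  by (simp add: path_sum_def)

lemma path_sum_mono:
  assumes "\<And>B e. A \<subseteq> B \<Longrightarrow> e \<notin> B \<Longrightarrow> F B e \<le> F' B e"
  shows "path_sum F t A \<phi> \<le> path_sum F' t A \<phi>"
  unfolding path_sum_def
proof (intro sum_mono)
  fix B e
  show "visit t A \<phi> B e * F B e \<le> visit t A \<phi> B e * F' B e"
    using assms[of B e] visit_outside[of A B e t \<phi>]
    by (cases "A \<subseteq> B \<and> e \<notin> B") (auto intro: mult_left_mono)
qed

lemma path_sum_nonneg: "(\<And>B e. 0 \<le> F B e) \<Longrightarrow> 0 \<le> path_sum F t A \<phi>"
  unfolding path_sum_def by (intro sum_nonneg mult_nonneg_nonneg) auto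

lemma expectation_finite_type:
  "measure_pmf.expectation q F = (\<Sum>y\<in>UNIV. pmf q y * F y)" for F :: "'a::finite \<Rightarrow> real"
  by (subst integral_measure_pmf_real[where A = UNIV]) (auto simp: mult.commute)

lemma integrable_finite_type [simp]:
  "integrable (measure_pmf q) F" for F :: "'a::finite \<Rightarrow> real"
  by (rule integrable_measure_pmf_finite) simp

lemma integrable_expectation_plan_items [simp]:
  "integrable (measure_pmf D) (\<lambda>t. measure_pmf.expectation (plan_items t \<phi>) F)"
  for F :: "'e::finite set \<Rightarrow> real"
  by (rule integral_bind_pmf_integrable(1)) simp

lemma expectation_plan_items_Randomize [simp]:
  "measure_pmf.expectation (bind_pmf D (\<lambda>t. plan_items t \<phi>)) F =
     measure_pmf.expectation D (\<lambda>t. measure_pmf.expectation (plan_items t \<phi>) F)"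
  for F :: "'e::finite set \<Rightarrow> real"
  by (rule integral_bind_pmf_integrable(2)) simp

text \<open>Increments along a branch telescope; a repeated selection changes neither side.\<close>

lemma path_sum_telescope:
  "path_sum (\<lambda>B e. F (insert e B) - F B) t A \<phi> =
     measure_pmf.expectation (plan_items t \<phi>) (\<lambda>Y. F (A \<union> Y)) - F A"
proof (induction t arbitrary: A)
  case (Select x c)
  show ?case
    using Select.IH[of "c (\<phi> x)" "insert x A"] by (auto simp: insert_absorb)
next
  case (Randomize D)
  have "path_sum (\<lambda>B e. F (insert e B) - F B) (Randomize D) A \<phi> =
      (\<integral>t. measure_pmf.expectation (plan_items t \<phi>) (\<lambda>Y. F (A \<union> Y)) - F A \<partial>D)"
    unfolding path_sum_Randomize
    by (intro integral_cong_AE) (auto simp: AE_measure_pmf_iff Randomize.IH)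
  then show ?case
    by simp
qed auto

text \<open>The induction follows the branch of \<open>\<phi>\<close>. As \<open>\<phi>\<close> lies
  in the support, every state met is observable, which is where \<open>first_then\<close> constrains
  continuations.\<close>

lemma first_then_subset:
  assumes "first_then p Q S \<psi> t" and "\<psi> = observe \<phi> A" and "\<phi> \<in> set_pmf p"
    and "Y \<in> set_pmf (plan_items t \<phi>)"
  shows "S \<subseteq> Y"
  using assms
proof (induction arbitrary: A Y rule: first_then.induct)
  case (select e S \<psi> c)
  then obtain Z where Z: "Y = insert e Z" "Z \<in> set_pmf (plan_items (c (\<phi> e)) \<phi>)"
    by auto
  have "S - {e} \<subseteq> Z"
    using select.prems Z possible_states_observe[of \<phi> p e A]
    by (intro select.IH[where A = "insert e A" and s = "\<phi> e"]) auto
  then show ?case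
    using Z by auto
next
  case (randomize D S \<psi>)
  then obtain t where "t \<in> set_pmf D" "Y \<in> set_pmf (plan_items t \<phi>)"
    by auto
  then show ?case
    using randomize by blast
qed auto

subsection \<open>Adaptive submodular and monotone utilities\<close>

locale adaptive_utility =
  fixes p :: "('e::finite \<Rightarrow> 'o) pmf" and u :: "('e, 'o) utility"
  assumes nonneg: "0 \<le> u Y \<phi>"
    and integrable: "integrable (measure_pmf p) (u Y)"
    and submodular: "adaptive_submodular p u"
    and monotone: "adaptive_monotone p u"
begin

abbreviation \<Delta> where "\<Delta> \<equiv> gain p u"

text \<open>The hypotheses on marginals concern new items; gain zero for old ones extends
  monotonicity and submodularity to all items.\<close>

lemma gain_selected: "e \<in> A \<Longrightarrow> \<Delta> A \<phi> e = 0"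
  by (simp add: gain_def marginal_def insert_absorb)

lemma gain_nonneg: "\<phi> \<in> set_pmf p \<Longrightarrow> 0 \<le> \<Delta> A \<phi> e"
  using monotone gain_selected[of e A \<phi>] possible_observe[of \<phi> p A]
  by (cases "e \<in> A") (auto simp: adaptive_monotone_def gain_def)

lemma gain_antimono: "\<phi> \<in> set_pmf p \<Longrightarrow> A \<subseteq> B \<Longrightarrow> \<Delta> B \<phi> e \<le> \<Delta> A \<phi> e"
proof (cases "e \<in> B")
  case True
  then show "\<phi> \<in> set_pmf p \<Longrightarrow> \<Delta> B \<phi> e \<le> \<Delta> A \<phi> e"
    by (simp add: gain_selected gain_nonneg)
next
  case False
  then show "\<phi> \<in> set_pmf p \<Longrightarrow> A \<subseteq> B \<Longrightarrow> \<Delta> B \<phi> e \<le> \<Delta> A \<phi> e"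
    using submodular possible_observe[of \<phi> p] observe_mono[of A B \<phi>]
    by (auto simp: adaptive_submodular_def gain_def)
qed

definition best :: "'e set \<Rightarrow> ('e \<Rightarrow> 'o) \<Rightarrow> real" where
  "best A \<phi> = Max (range (\<Delta> A \<phi>))"

lemma gain_le_best: "\<Delta> A \<phi> e \<le> best A \<phi>"
  by (simp add: best_def)

lemma best_nonneg: "\<phi> \<in> set_pmf p \<Longrightarrow> 0 \<le> best A \<phi>"
  using gain_nonneg gain_le_best by (meson order.trans)

lemma best_antimono: "\<phi> \<in> set_pmf p \<Longrightarrow> A \<subseteq> B \<Longrightarrow> best B \<phi> \<le> best A \<phi>"
  unfolding best_def[of B]
  by (intro Max.boundedI) (auto intro: order.trans[OF gain_antimono gain_le_best])

lemma best_eq_greedy: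
  "is_arg_max (\<lambda>e. marginal p u e (observe \<phi> A)) (\<lambda>e. e \<in> UNIV) x \<Longrightarrow> best A \<phi> = \<Delta> A \<phi> x"
  unfolding best_def by (intro Max_eqI) (auto simp: is_arg_max_linorder gain_def)

text \<open>Each of the \<open>r\<close> rounds gains the current maximum, which by submodularity is
  at least the maximum left at the end of the run. As \<open>S \<subseteq> A\<close>, joining
  \<open>S\<close> changes nothing yet.\<close>

lemma greedy_rounds_path_sum:
  assumes "greedy_rounds p u r \<psi> t" and "\<psi> = observe \<phi> A" and "\<phi> \<in> set_pmf p" and "S \<subseteq> A"
  shows "real r * measure_pmf.expectation (plan_items t \<phi>) (\<lambda>Y. best (A \<union> Y) \<phi>) \<le>
    path_sum (\<lambda>B. \<Delta> (B \<union> S) \<phi>) t A \<phi>"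
  using assms
proof (induction arbitrary: A rule: greedy_rounds.induct)
  case (select \<psi> x r c)
  let ?E = "measure_pmf.expectation (plan_items (c (\<phi> x)) \<phi>) (\<lambda>Y. best (insert x A \<union> Y) \<phi>)"
  have IH: "real r * ?E \<le> path_sum (\<lambda>B. \<Delta> (B \<union> S) \<phi>) (c (\<phi> x)) (insert x A) \<phi>"
    using select.prems possible_states_observe[of \<phi> p x A]
    by (intro select.IH) auto
  have x: "best A \<phi> = \<Delta> A \<phi> x"
    using select.hyps(1) select.prems by (simp add: best_eq_greedy)
  have "?E \<le> best A \<phi>"
    using select.prems
    by (intro measure_pmf.integral_le_const) (auto simp: AE_measure_pmf_iff intro!: best_antimono)
  \<comment> \<open>If the maximizer \<open>x\<close> is already in \<open>A\<close>, the maximum is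
    zero, so a round that \<open>path_sum\<close> does not count loses nothing.\<close>
  also have "best A \<phi> = (if x \<in> A then 0 else \<Delta> (A \<union> S) \<phi> x)"
    using x select.prems by (auto simp: gain_selected Un_absorb2)
  finally show ?case
    using IH by (simp add: algebra_simps)
next
  case (randomize D r \<psi>)
  let ?E = "\<lambda>t. measure_pmf.expectation (plan_items t \<phi>) (\<lambda>Y. best (A \<union> Y) \<phi>)"
  have "(\<integral>t. real r * ?E t \<partial>D) \<le> (\<integral>t. path_sum (\<lambda>B. \<Delta> (B \<union> S) \<phi>) t A \<phi> \<partial>D)"
    using randomize by (intro integral_mono_AE) (auto simp: AE_measure_pmf_iff)
  then show ?case
    by simp
qed auto

text \<open>First-phase selections contribute nonnegative gains and are dropped; when
  \<open>T\<close> is exhausted, \<open>S \<subseteq> A\<close> and the greedy rounds take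
  over.\<close>

lemma first_then_greedy_path_sum:
  assumes "first_then p (greedy_rounds p u r) T \<psi> t" and "\<psi> = observe \<phi> A"
    and "\<phi> \<in> set_pmf p" and "S \<subseteq> A \<union> T"
  shows "real r * measure_pmf.expectation (plan_items t \<phi>) (\<lambda>Y. best (A \<union> Y) \<phi>) \<le>
    path_sum (\<lambda>B. \<Delta> (B \<union> S) \<phi>) t A \<phi>"
  using assms
proof (induction arbitrary: A rule: first_then.induct)
  case (finished \<psi> t)
  then show ?case
    by (intro greedy_rounds_path_sum) auto
next
  case (select x T \<psi> c)
  have "real r * measure_pmf.expectation (plan_items (c (\<phi> x)) \<phi>) (\<lambda>Y. best (insert x A \<union> Y) \<phi>)
      \<le> path_sum (\<lambda>B. \<Delta> (B \<union> S) \<phi>) (c (\<phi> x)) (insert x A) \<phi>"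
    using select.prems possible_states_observe[of \<phi> p x A]
    by (intro select.IH) auto
  then show ?case
    using gain_nonneg[OF select.prems(2), of "A \<union> S" x] by auto
next
  case (randomize D T \<psi>)
  let ?E = "\<lambda>t. measure_pmf.expectation (plan_items t \<phi>) (\<lambda>Y. best (A \<union> Y) \<phi>)"
  have "(\<integral>t. real r * ?E t \<partial>D) \<le> (\<integral>t. path_sum (\<lambda>B. \<Delta> (B \<union> S) \<phi>) t A \<phi> \<partial>D)"
    using randomize by (intro integral_mono_AE) (auto simp: AE_measure_pmf_iff)
  then show ?case
    by simp
qed

end

section \<open>Values of plans as expected sums of gains\<close>

definition plan_value :: "('e::finite \<Rightarrow> 'o) pmf \<Rightarrow> ('e, 'o) utility \<Rightarrow> ('e, 'o) plan \<Rightarrow> real" where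
  "plan_value p u t = measure_pmf.expectation p
     (\<lambda>\<phi>. measure_pmf.expectation (plan_items t \<phi>) (\<lambda>Y. u Y \<phi>))"

context adaptive_utility
begin

lemma integrable_weighted_utility:
  "(\<And>\<phi>. \<bar>w \<phi>\<bar> \<le> 1) \<Longrightarrow> integrable (measure_pmf p) (\<lambda>\<phi>. w \<phi> * u Y \<phi>)"
  by (intro integrable_mult_bounded integrable)

lemma integrable_plan_items_utility:
  "integrable (measure_pmf p)
     (\<lambda>\<phi>. measure_pmf.expectation (plan_items t \<phi>) (\<lambda>Y. u (g Y) \<phi>))"
  unfolding expectation_finite_type
  by (intro Bochner_Integration.integrable_sum integrable_weighted_utility) (simp add: pmf_le_1)

text \<open>Fubini on pairs of an item set and a realization. The dominating function sums
  \<open>u Y\<close> over all \<open>Y\<close>, so it depends on the realization alone, whose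
  marginal law is \<open>p\<close>.\<close>

lemma task_value_eq_plan_value:
  assumes "f i = u"
  shows "task_value p f \<pi> i = plan_value p u (\<pi> i)"
proof -
  let ?q = "bind_pmf p (\<lambda>\<phi>. map_pmf (\<lambda>Y. (Y, \<phi>)) (selected_items \<pi> \<phi> i))"
  have snd: "map_pmf snd ?q = p"
    by (simp add: map_bind_pmf map_pmf_comp bind_return_pmf')
  have "integrable (measure_pmf p) (\<lambda>\<phi>. \<Sum>Y\<in>UNIV. u Y \<phi>)"
    using integrable by simp
  then have sum: "integrable (measure_pmf ?q) (\<lambda>x. \<Sum>Y\<in>UNIV. u Y (snd x))"
    by (subst (asm) snd[symmetric]) (simp only: integrable_map_pmf_eq)
  have "u (fst x) (snd x) \<le> (\<Sum>Y\<in>UNIV. u Y (snd x))" for x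
    using nonneg by (intro member_le_sum) auto
  then have "integrable (measure_pmf ?q) (\<lambda>(Y, \<phi>). u Y \<phi>)"
    using nonneg
    by (intro Bochner_Integration.integrable_bound[OF sum]) (auto simp: case_prod_beta sum_nonneg)
  from integral_bind_pmf_integrable(2)[OF this] show ?thesis
    by (simp add: task_value_def plan_value_def selected_items_def assms)
qed

text \<open>The weight \<open>w * visit\<close> vanishes unless \<open>A \<subseteq> B\<close> and
  then depends on the states in \<open>B\<close>, so gains can be traded for actual increments of
  \<open>u\<close>, which telescope for fixed \<open>\<phi>\<close>.\<close>

lemma expectation_path_sum:
  assumes w: "depends_on A w" "\<And>\<phi>. \<bar>w \<phi>\<bar> \<le> (1::real)"
  shows "integrable (measure_pmf p) (\<lambda>\<phi>. w \<phi> * path_sum (\<lambda>B. \<Delta> (B \<union> S) \<phi>) t A \<phi>)"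
    and "measure_pmf.expectation p (\<lambda>\<phi>. w \<phi> * path_sum (\<lambda>B. \<Delta> (B \<union> S) \<phi>) t A \<phi>) =
      measure_pmf.expectation p (\<lambda>\<phi>. w \<phi> *
        (measure_pmf.expectation (plan_items t \<phi>) (\<lambda>Y. u (A \<union> Y \<union> S) \<phi>) - u (A \<union> S) \<phi>))"
proof -
  let ?v = "\<lambda>B e \<phi>. w \<phi> * visit t A \<phi> B e"
  have dep: "depends_on (B \<union> S) (?v B e)" for B e
  proof (cases "A \<subseteq> B")
    case True
    then show ?thesis
      using w(1) depends_on_visit[of B t A e]
      by (intro depends_on_mult) (auto intro: depends_on_mono)
  next
    case False
    then show ?thesis
      by (simp add: visit_outside depends_on_def)
  qed
  have bound: "\<bar>?v B e \<phi>\<bar> \<le> 1" for B e \<phi>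
    using w(2) by (auto simp: abs_mult intro: mult_le_one)
  note gains = expectation_gain[OF integrable dep bound]
  have sum: "w \<phi> * path_sum F t A \<phi> = (\<Sum>B\<in>UNIV. \<Sum>e\<in>UNIV. ?v B e \<phi> * F B e)" for F \<phi>
    by (simp add: path_sum_def sum_distrib_left mult.assoc)
  show "integrable (measure_pmf p) (\<lambda>\<phi>. w \<phi> * path_sum (\<lambda>B. \<Delta> (B \<union> S) \<phi>) t A \<phi>)"
    unfolding sum by (intro Bochner_Integration.integrable_sum gains)
  have "measure_pmf.expectation p (\<lambda>\<phi>. w \<phi> * path_sum (\<lambda>B. \<Delta> (B \<union> S) \<phi>) t A \<phi>) =
      (\<Sum>B\<in>UNIV. \<Sum>e\<in>UNIV. measure_pmf.expectation p (\<lambda>\<phi>. ?v B e \<phi> * \<Delta> (B \<union> S) \<phi> e))"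
    unfolding sum by (simp add: Bochner_Integration.integral_sum gains)
  also have "\<dots> = (\<Sum>B\<in>UNIV. \<Sum>e\<in>UNIV. measure_pmf.expectation p
      (\<lambda>\<phi>. ?v B e \<phi> * (u (insert e (B \<union> S)) \<phi> - u (B \<union> S) \<phi>)))"
    by (simp only: gains(2))
  also have "\<dots> = measure_pmf.expectation p
      (\<lambda>\<phi>. w \<phi> * path_sum (\<lambda>B e. u (insert e B \<union> S) \<phi> - u (B \<union> S) \<phi>) t A \<phi>)"
    unfolding sum using bound integrable
    by (subst Bochner_Integration.integral_sum | intro Bochner_Integration.integrable_sum
        integrable_mult_bounded | simp)+
  also have "\<dots> = measure_pmf.expectation p (\<lambda>\<phi>. w \<phi> *
        (measure_pmf.expectation (plan_items t \<phi>) (\<lambda>Y. u (A \<union> Y \<union> S) \<phi>) - u (A \<union> S) \<phi>))"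
    using path_sum_telescope[where F = "\<lambda>Y. u (Y \<union> S) \<phi>" and \<phi> = \<phi> for \<phi>] by simp
  finally show "measure_pmf.expectation p (\<lambda>\<phi>. w \<phi> * path_sum (\<lambda>B. \<Delta> (B \<union> S) \<phi>) t A \<phi>) =
      measure_pmf.expectation p (\<lambda>\<phi>. w \<phi> *
        (measure_pmf.expectation (plan_items t \<phi>) (\<lambda>Y. u (A \<union> Y \<union> S) \<phi>) - u (A \<union> S) \<phi>))" .
qed

section \<open>Running a second plan after the first\<close>

text \<open>Submodularity replaces each gain by the one at the start \<open>A\<close>, making the
  sum additive in the items. The items of \<open>T\<close> are kept individually; at most
  \<open>r\<close> others are each bounded by the best gain.\<close>

lemma path_sum_le_best:
  assumes \<phi>: "\<phi> \<in> set_pmf p"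
    and T: "\<And>Y. Y \<in> set_pmf (plan_items t \<phi>) \<Longrightarrow> T \<subseteq> Y"
    and k: "\<And>Y. Y \<in> set_pmf (plan_items t \<phi>) \<Longrightarrow> card Y \<le> card T + r"
  shows "path_sum (\<lambda>B. \<Delta> B \<phi>) t A \<phi> \<le> (\<Sum>e\<in>T. \<Delta> A \<phi> e) + real r * best A \<phi>"
proof -
  let ?F = "\<lambda>Y. \<Sum>e\<in>Y. \<Delta> A \<phi> e"
  have "path_sum (\<lambda>B. \<Delta> B \<phi>) t A \<phi> \<le> path_sum (\<lambda>B e. ?F (insert e B) - ?F B) t A \<phi>"
    using \<phi> by (intro path_sum_mono) (simp add: gain_antimono)
  also have "\<dots> = measure_pmf.expectation (plan_items t \<phi>) (\<lambda>Y. ?F (A \<union> Y))"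
    by (simp add: path_sum_telescope gain_selected)
  also have "\<dots> \<le> ?F T + real r * best A \<phi>"
  proof (intro measure_pmf.integral_le_const, simp, unfold AE_measure_pmf_iff, intro ballI)
    fix Y assume Y: "Y \<in> set_pmf (plan_items t \<phi>)"
    have "?F (A \<union> Y) = ?F Y"
      by (intro sum.mono_neutral_right) (auto simp: gain_selected)
    also have "\<dots> = ?F T + ?F (Y - T)"
      using T[OF Y] by (simp add: sum.subset_diff)
    also have "?F (Y - T) \<le> real (card (Y - T)) * best A \<phi>"
      by (rule sum_bounded_above) (rule gain_le_best)
    also have "\<dots> \<le> real r * best A \<phi>"
      using k[OF Y] T[OF Y] \<phi> by (intro mult_right_mono) (auto simp: card_Diff_subset best_nonneg)
    finally show "?F (A \<union> Y) \<le> ?F T + real r * best A \<phi>"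
      by simp
  qed
  finally show ?thesis .
qed

definition final_gain :: "('e, 'o) plan \<Rightarrow> 'e \<Rightarrow> real" where
  "final_gain t e = measure_pmf.expectation p
     (\<lambda>\<phi>. measure_pmf.expectation (plan_items t \<phi>) (\<lambda>Y. \<Delta> Y \<phi> e))"

lemma integrable_final_gain:
  "integrable (measure_pmf p) (\<lambda>\<phi>. measure_pmf.expectation (plan_items t \<phi>) (\<lambda>Y. \<Delta> Y \<phi> e))"
  unfolding expectation_finite_type
  by (intro Bochner_Integration.integrable_sum expectation_gain integrable depends_on_plan_items)
    (simp add: pmf_le_1)

text \<open>The plan surely selects \<open>T\<close>, so submodularity moves the gain back from the
  final set to \<open>T\<close>. Later \<open>T\<close> ranges over subsets of the greedy initial
  set.\<close>

lemma final_gain_le: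
  assumes T: "\<And>\<phi> Y. \<phi> \<in> set_pmf p \<Longrightarrow> Y \<in> set_pmf (plan_items t \<phi>) \<Longrightarrow> T \<subseteq> Y"
  shows "final_gain t e \<le> expected_utility p u (insert e T) - expected_utility p u T"
proof -
  note gain = expectation_gain[of p u T "\<lambda>_. 1" e, OF integrable]
  have "final_gain t e \<le> measure_pmf.expectation p (\<lambda>\<phi>. \<Delta> T \<phi> e)"
    unfolding final_gain_def
  proof (intro integral_mono_AE integrable_final_gain, unfold AE_measure_pmf_iff)
    show "integrable (measure_pmf p) (\<lambda>\<phi>. \<Delta> T \<phi> e)"
      using gain(1) by (simp add: depends_on_def)
    show "\<forall>\<phi>\<in>set_pmf p. measure_pmf.expectation (plan_items t \<phi>) (\<lambda>Y. \<Delta> Y \<phi> e) \<le> \<Delta> T \<phi> e"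
      by (intro ballI measure_pmf.integral_le_const)
        (auto intro: gain_antimono[OF _ T] simp: AE_measure_pmf_iff)
  qed
  also have "\<dots> = measure_pmf.expectation p (\<lambda>\<phi>. u (insert e T) \<phi> - u T \<phi>)"
    using gain(2) by (simp add: depends_on_def)
  also have "\<dots> = expected_utility p u (insert e T) - expected_utility p u T"
    using integrable by (simp add: expected_utility_def)
  finally show ?thesis .
qed

text \<open>The value of running two plans one after the other, each ignoring the observations made by
  the other one.\<close>

definition joint_value :: "('e, 'o) plan \<Rightarrow> ('e, 'o) plan \<Rightarrow> real" where
  "joint_value s t = measure_pmf.expectation p (\<lambda>\<phi>.
     measure_pmf.expectation (plan_items s \<phi>) (\<lambda>X.
       measure_pmf.expectation (plan_items t \<phi>) (\<lambda>Y. u (X \<union> Y) \<phi>)))"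

text \<open>Given \<open>\<phi>\<close>, the runs are independent. The symmetry lets monotonicity be
  applied with the optimal plan first and the gain bound with the greedy plan first.\<close>

lemma joint_value_commute: "joint_value s t = joint_value t s"
proof -
  have "measure_pmf.expectation (plan_items s \<phi>) (\<lambda>X.
          measure_pmf.expectation (plan_items t \<phi>) (\<lambda>Y. u (X \<union> Y) \<phi>)) =
        measure_pmf.expectation (plan_items t \<phi>) (\<lambda>Y.
          measure_pmf.expectation (plan_items s \<phi>) (\<lambda>X. u (Y \<union> X) \<phi>))" for \<phi>
    unfolding expectation_finite_type sum_distrib_left
    by (subst sum.swap) (simp add: Un_commute mult.left_commute)
  then show ?thesis
    by (simp add: joint_value_def)
qed

text \<open>Split by the final set \<open>X\<close> of \<open>s\<close>: its probability depends
  only on the states in \<open>X\<close>, hence can serve as the weight for \<open>t\<close> started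
  from \<open>X\<close>.\<close>

lemma joint_value_minus_plan_value:
  shows "integrable (measure_pmf p) (\<lambda>\<phi>. measure_pmf.expectation (plan_items s \<phi>)
      (\<lambda>X. path_sum (\<lambda>B. \<Delta> B \<phi>) t X \<phi>))"
    and "joint_value s t - plan_value p u s = measure_pmf.expectation p
      (\<lambda>\<phi>. measure_pmf.expectation (plan_items s \<phi>) (\<lambda>X. path_sum (\<lambda>B. \<Delta> B \<phi>) t X \<phi>))"
proof -
  let ?V = "\<lambda>X \<phi>. measure_pmf.expectation (plan_items t \<phi>) (\<lambda>Y. u (X \<union> Y) \<phi>)"
  have "\<bar>pmf (plan_items s \<phi>) X\<bar> \<le> 1" for \<phi> X
    by (simp add: pmf_le_1)
  note paths = expectation_path_sum[OF depends_on_plan_items this, where S = "{}", simplified]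
  note wint = integrable_mult_bounded[of p _ "\<lambda>\<phi>. pmf (plan_items s \<phi>) X" for X]
  have V: "integrable (measure_pmf p) (\<lambda>\<phi>. pmf (plan_items s \<phi>) X * ?V X \<phi>)" for X
    by (intro wint integrable_plan_items_utility) (simp add: pmf_le_1)
  have U: "integrable (measure_pmf p) (\<lambda>\<phi>. pmf (plan_items s \<phi>) X * u X \<phi>)" for X
    by (intro wint integrable) (simp add: pmf_le_1)
  show "integrable (measure_pmf p) (\<lambda>\<phi>. measure_pmf.expectation (plan_items s \<phi>)
      (\<lambda>X. path_sum (\<lambda>B. \<Delta> B \<phi>) t X \<phi>))"
    unfolding expectation_finite_type[of "plan_items s _"]
    by (intro Bochner_Integration.integrable_sum paths)
  have "measure_pmf.expectation p
      (\<lambda>\<phi>. measure_pmf.expectation (plan_items s \<phi>) (\<lambda>X. path_sum (\<lambda>B. \<Delta> B \<phi>) t X \<phi>)) =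
      (\<Sum>X\<in>UNIV. measure_pmf.expectation p
        (\<lambda>\<phi>. pmf (plan_items s \<phi>) X * ?V X \<phi> - pmf (plan_items s \<phi>) X * u X \<phi>))"
    unfolding expectation_finite_type[of "plan_items s _"]
    by (simp add: Bochner_Integration.integral_sum paths right_diff_distrib)
  also have "\<dots> = joint_value s t - plan_value p u s"
    unfolding joint_value_def plan_value_def expectation_finite_type[of "plan_items s _"]
    by (simp add: Bochner_Integration.integral_sum V U sum_subtractf)
  finally show "joint_value s t - plan_value p u s = measure_pmf.expectation p
      (\<lambda>\<phi>. measure_pmf.expectation (plan_items s \<phi>) (\<lambda>X. path_sum (\<lambda>B. \<Delta> B \<phi>) t X \<phi>))"
    by simp
qed

lemma plan_value_le_joint_value: "plan_value p u s \<le> joint_value s t"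
proof -
  have "0 \<le> measure_pmf.expectation p
      (\<lambda>\<phi>. measure_pmf.expectation (plan_items s \<phi>) (\<lambda>X. path_sum (\<lambda>B. \<Delta> B \<phi>) t X \<phi>))"
    by (intro integral_nonneg_AE)
      (auto simp: AE_measure_pmf_iff gain_nonneg intro!: integral_nonneg_AE path_sum_nonneg)
  then show ?thesis
    using joint_value_minus_plan_value(2)[of s t] by simp
qed

text \<open>The joint run is worth at least \<open>t\<close>. What \<open>t\<close> adds to
  \<open>tg\<close> is bounded by the final gains of \<open>T\<close> plus \<open>r\<close> best
  gains, and the latter by what the second phase of \<open>tg\<close> adds to
  \<open>S\<close>.\<close>

lemma plan_value_le_greedy:
  assumes greedy: "first_then p (greedy_rounds p u r) S Map.empty tg"
    and opt: "first_then p Q T Map.empty t"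
    and k: "\<And>\<phi> Y. \<phi> \<in> set_pmf p \<Longrightarrow> Y \<in> set_pmf (plan_items t \<phi>) \<Longrightarrow> card Y \<le> card T + r"
  shows "plan_value p u t \<le>
    2 * plan_value p u tg - expected_utility p u S + (\<Sum>e\<in>T. final_gain tg e)"
proof -
  let ?E = "\<lambda>\<phi>. measure_pmf.expectation (plan_items tg \<phi>)"
  let ?P = "\<lambda>\<phi>. path_sum (\<lambda>B. \<Delta> (B \<union> S) \<phi>) tg {} \<phi>"
  have S: "S \<subseteq> Y" if "\<phi> \<in> set_pmf p" "Y \<in> set_pmf (plan_items tg \<phi>)" for \<phi> Y
    using first_then_subset[OF greedy, of \<phi> "{}"] that by simp
  have T: "T \<subseteq> Y" if "\<phi> \<in> set_pmf p" "Y \<in> set_pmf (plan_items t \<phi>)" for \<phi> Y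
    using first_then_subset[OF opt, of \<phi> "{}"] that by simp
  have pointwise: "?E \<phi> (\<lambda>X. path_sum (\<lambda>B. \<Delta> B \<phi>) t X \<phi>) \<le>
      (\<Sum>e\<in>T. ?E \<phi> (\<lambda>X. \<Delta> X \<phi> e)) + ?P \<phi>" if \<phi>: "\<phi> \<in> set_pmf p" for \<phi>
  proof -
    have "?E \<phi> (\<lambda>X. path_sum (\<lambda>B. \<Delta> B \<phi>) t X \<phi>) \<le>
        ?E \<phi> (\<lambda>X. (\<Sum>e\<in>T. \<Delta> X \<phi> e) + real r * best X \<phi>)"
      using \<phi> T k by (intro integral_mono path_sum_le_best) auto
    also have "\<dots> = (\<Sum>e\<in>T. ?E \<phi> (\<lambda>X. \<Delta> X \<phi> e)) + real r * ?E \<phi> (\<lambda>X. best X \<phi>)"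
      by (simp add: Bochner_Integration.integral_add Bochner_Integration.integral_sum)
    also have "real r * ?E \<phi> (\<lambda>X. best X \<phi>) \<le> ?P \<phi>"
      using first_then_greedy_path_sum[OF greedy, of \<phi> "{}" S] \<phi> by simp
    finally show ?thesis
      by simp
  qed
  note phase2 = expectation_path_sum[of "{}" "\<lambda>_. 1" S tg, simplified]
  have "joint_value tg t - plan_value p u tg \<le>
      measure_pmf.expectation p (\<lambda>\<phi>. (\<Sum>e\<in>T. ?E \<phi> (\<lambda>X. \<Delta> X \<phi> e)) + ?P \<phi>)"
    unfolding joint_value_minus_plan_value(2)
    using pointwise phase2(1)
    by (intro integral_mono_AE joint_value_minus_plan_value(1) Bochner_Integration.integrable_add
        Bochner_Integration.integrable_sum integrable_final_gain)
      (auto simp: AE_measure_pmf_iff depends_on_def)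
  also have "\<dots> = (\<Sum>e\<in>T. final_gain tg e) + measure_pmf.expectation p ?P"
    using phase2(1) unfolding final_gain_def
    by (simp add: Bochner_Integration.integral_add Bochner_Integration.integral_sum
        integrable_final_gain depends_on_def)
  also have "measure_pmf.expectation p ?P =
      measure_pmf.expectation p (\<lambda>\<phi>. ?E \<phi> (\<lambda>Y. u (Y \<union> S) \<phi>) - u S \<phi>)"
    using phase2(2) by (simp add: depends_on_def)
  \<comment> \<open>The greedy plan surely selects \<open>S\<close>, so joining \<open>S\<close> to
    its outcome changes nothing.\<close>
  also have "\<dots> = measure_pmf.expectation p (\<lambda>\<phi>. ?E \<phi> (\<lambda>Y. u Y \<phi>) - u S \<phi>)"
  proof (intro integral_cong_AE, simp_all, unfold AE_measure_pmf_iff, intro ballI)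
    fix \<phi> assume "\<phi> \<in> set_pmf p"
    then show "?E \<phi> (\<lambda>Y. u (Y \<union> S) \<phi>) = ?E \<phi> (\<lambda>Y. u Y \<phi>)"
      using S by (intro integral_cong_AE) (auto simp: AE_measure_pmf_iff Un_absorb2)
  qed
  also have "\<dots> = plan_value p u tg - expected_utility p u S"
    using integrable integrable_plan_items_utility[of tg "\<lambda>Y. Y"]
    by (simp add: plan_value_def expected_utility_def)
  finally show ?thesis
    using plan_value_le_joint_value[of t tg] joint_value_commute[of t tg] by simp
qed

end

subsection \<open>The approximation ratio\<close>

text \<open>Exchange argument: \<open>c i e\<close> bounds the gain at every subset of
  \<open>S\<close>, so the items of \<open>T\<close> can be matched with the greedy rounds in any
  order. What counts is the number \<open>j\<close> of rounds; repeated choices may make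
  \<open>S\<close> smaller.\<close>

lemma greedy_initial_set_bound:
  assumes "greedy_initial_set p f M j S" and "finite T" and "card T = j"
    and "\<And>i e S'. i \<in> M \<Longrightarrow> S' \<subseteq> S \<Longrightarrow>
      c i e \<le> expected_utility p (f i) (insert e S') - expected_utility p (f i) S'"
  shows "1 / real (card M) * (\<Sum>i\<in>M. \<Sum>e\<in>T. c i e) \<le>
    1 / real (card M) * (\<Sum>i\<in>M. expected_utility p (f i) S - expected_utility p (f i) {})"
  using assms
proof (induction arbitrary: T rule: greedy_initial_set.induct)
  case (2 j S e)
  let ?U = "\<lambda>i. expected_utility p (f i)"
  let ?m = "1 / real (card M)"
  from 2 obtain x where x: "x \<in> T"
    by fastforce
  have c: "c i e' \<le> ?U i (insert e' S') - ?U i S'" if "i \<in> M" "S' \<subseteq> S" for i e' S'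
    using that by (intro "2.prems"(3)) auto
  have "?m * (\<Sum>i\<in>M. \<Sum>e\<in>T - {x}. c i e) \<le> ?m * (\<Sum>i\<in>M. ?U i S - ?U i {})"
    using "2.prems"(1,2) x c by (intro "2.IH") simp_all
  moreover have "?m * (\<Sum>i\<in>M. c i x) \<le> ?m * (\<Sum>i\<in>M. ?U i (S \<union> {x}) - ?U i S)"
    using c by (intro mult_left_mono sum_mono) auto
  moreover have "\<dots> \<le> ?m * (\<Sum>i\<in>M. ?U i (S \<union> {e}) - ?U i S)"
    using "2.hyps"(2) by (simp add: is_arg_max_linorder)
  moreover have "(\<Sum>i\<in>M. \<Sum>e\<in>T. c i e) = (\<Sum>i\<in>M. c i x) + (\<Sum>i\<in>M. \<Sum>e\<in>T - {x}. c i e)"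
    using x 2 by (simp add: sum.remove sum.distrib)
  ultimately show ?case
    by (simp only: sum_subtractf distrib_left right_diff_distrib)
qed simp

theorem theorem1:
  fixes p :: "('e::finite \<Rightarrow> 'o) pmf"
    and f :: "'g \<Rightarrow> 'e set \<Rightarrow> ('e \<Rightarrow> 'o) \<Rightarrow> real"
    and G M :: "'g set"
    and l k :: nat
    and \<pi>g \<pi>o :: "('g, 'e, 'o) policy"
  assumes "M \<subseteq> G" and "finite M"
    and "0 < l" and "l < k"
    and "\<And>i Y \<phi>. i \<in> G \<Longrightarrow> 0 \<le> f i Y \<phi>"
    and "\<And>i Y. i \<in> G \<Longrightarrow> integrable (measure_pmf p) (f i Y)"
    and "\<And>i. i \<in> G \<Longrightarrow> adaptive_submodular p (f i)"
    and "\<And>i. i \<in> G \<Longrightarrow> adaptive_monotone p (f i)"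
    and "two_phase_greedy p f G M l k \<pi>g"
    and "optimal_meta_policy p f G M l k \<pi>o"
  shows "average_value p f M \<pi>g \<ge> 1 / 2 * average_value p f M \<pi>o"
proof -
  have util: "adaptive_utility p (f i)" if "i \<in> M" for i
    using that assms(1,5-8) by unfold_locales auto
  obtain S where S: "greedy_initial_set p f M l S"
    and greedy: "\<And>i. i \<in> G \<Longrightarrow> first_then p (greedy_rounds p (f i) (k - l)) S Map.empty (\<pi>g i)"
    using assms(9) by (auto simp: two_phase_greedy_def)
  obtain T where T: "card T = l" and opt: "\<pi>o \<in> meta_policies p G T k"
    using assms(10) by (auto simp: optimal_meta_policy_def)
  \<comment> \<open>For empty \<open>M\<close> the factor \<open>?m\<close> is
    \<open>1 / 0 = 0\<close>.\<close>
  let ?m = "1 / real (card M)" and ?U = "\<lambda>i. expected_utility p (f i)"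
  let ?c = "\<lambda>i. adaptive_utility.final_gain p (f i) (\<pi>g i)"
  \<comment> \<open>The greedy rounds account only for the increase over the empty set, whose
    utility need not be zero; being nonnegative, it can be added to the bound.\<close>
  have U: "0 \<le> ?U i {}" if "i \<in> M" for i
    using assms(1,5) that by (auto simp: expected_utility_def intro!: integral_nonneg_AE)
  have "task_value p f \<pi>o i \<le>
      2 * task_value p f \<pi>g i + ((\<Sum>e\<in>T. ?c i e) - (?U i S - ?U i {}))" if i: "i \<in> M" for i
  proof -
    interpret adaptive_utility p "f i"
      by (rule util[OF i])
    have "plan_value p (f i) (\<pi>o i) \<le>
        2 * plan_value p (f i) (\<pi>g i) - ?U i S + (\<Sum>e\<in>T. ?c i e)"
      using opt assms(1,4) i T
      by (intro plan_value_le_greedy[where Q = "\<lambda>_ _. True" and r = "k - l"] greedy)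
        (auto simp: meta_policies_def selected_items_def)
    then show ?thesis
      using U[OF i] task_value_eq_plan_value[of f i, OF refl] by simp
  qed
  then have "(\<Sum>i\<in>M. task_value p f \<pi>o i) \<le>
      (\<Sum>i\<in>M. 2 * task_value p f \<pi>g i + ((\<Sum>e\<in>T. ?c i e) - (?U i S - ?U i {})))"
    by (rule sum_mono)
  then have "average_value p f M \<pi>o \<le> 2 * average_value p f M \<pi>g +
      (?m * (\<Sum>i\<in>M. \<Sum>e\<in>T. ?c i e) - ?m * (\<Sum>i\<in>M. ?U i S - ?U i {}))"
    unfolding average_value_def
    by (auto simp: sum.distrib sum_subtractf sum_distrib_left[symmetric] divide_right_mono
        simp flip: add_divide_distrib diff_divide_distrib)
  \<comment> \<open>The final gains are admissible as \<open>c\<close> because the greedy plan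
    surely selects \<open>S\<close>, and so every \<open>S' \<subseteq> S\<close>.\<close>
  moreover have "?m * (\<Sum>i\<in>M. \<Sum>e\<in>T. ?c i e) \<le> ?m * (\<Sum>i\<in>M. ?U i S - ?U i {})"
  proof (rule greedy_initial_set_bound[OF S _ T])
    fix i e S' assume i: "i \<in> M" and S': "S' \<subseteq> S"
    interpret adaptive_utility p "f i"
      by (rule util[OF i])
    have "S \<subseteq> Y" if "\<phi> \<in> set_pmf p" "Y \<in> set_pmf (plan_items (\<pi>g i) \<phi>)" for \<phi> Y
      using first_then_subset[OF greedy, of i \<phi> "{}"] that i assms(1) by auto
    then show "?c i e \<le> ?U i (insert e S') - ?U i S'"
      using S' by (intro final_gain_le) blast
  qed simp
  ultimately show ?thesis
    by simp
qed

end
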